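(* Let $k,n\ge 1$. The action of the reparametrization group $G_k$ on the space $J_k\mathbb{C}^n$ of $k$-jets of holomorphic curves in $\mathbb{C}^n$ has a generic stabilizer.
   Context: $G_k\subset GL_k(\mathbb{C})$ is the complex algebraic group of all upper triangular $k\times k$ matrices $A(a_1,\dots,a_k)$, $a_1\in\mathbb{C}^*$, $a_2,\dots,a_k\in\mathbb{C}$, with entries $A_{ij}=\sum_{s_1+\cdots+s_i=j,\ s_l\ge 1} a_{s_1}\cdots a_{s_i}$. It corresponds to the group of reparametrizations $t\mapsto a_1t+a_2t^2+\cdots+a_kt^k$ modulo $t^{k+1}$. $J_k\mathbb{C}^n\cong\mathbb{C}^{nk}$ is the space of $k$-jets $(f'(0),\dots,f^{(k)}(0))$ of germs of holomorphic curves $f:(\mathbb{C},0)\to(\mathbb{C}^n,0)$, identified with $\mathrm{Hom}(\mathbb{C}^k,\mathbb{C}^n)$. $G_k$ acts linearly by reparametrization, i.e. by right multiplication of the $n\times k$ matrix $[f'(0),f''(0)/2!,\dots,f^{(k)}(0)/k!]$ by the matrices in $G_k$. Generic stabilizer: let an algebraic group $G$ with Lie algebra $\mathfrak{g}$ act on a variety $X$; for $x\in X$ let $G_x$ be the stabilizer and $\mathfrak{g}_x=\mathrm{Lie}(G_x)$. The action has a generic stabilizer if there is an open dense subset $U\subset X$ such that all the subalgebras $\mathfrak{g}_x$, $x\in U$, are $G$-conjugate. *)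

theory Defs
  imports
    "HOL-Analysis.Abstract_Topology"
    "HOL-Algebra.Group_Action"
    "HOL-Computational_Algebra.Formal_Power_Series"
    "Jordan_Normal_Form.Matrix"
begin

section \<open>The Zariski topology on spaces of complex matrices\<close>

inductive_set poly_functions :: "nat \<Rightarrow> nat \<Rightarrow> (complex mat \<Rightarrow> complex) set"
  for n k :: nat where
  const: "(\<lambda>_. c) \<in> poly_functions n k"
| entry: "i < n \<Longrightarrow> j < k \<Longrightarrow> (\<lambda>x. x $$ (i, j)) \<in> poly_functions n k"
| add: "p \<in> poly_functions n k \<Longrightarrow> q \<in> poly_functions n k \<Longrightarrow> (\<lambda>x. p x + q x) \<in> poly_functions n k"
| mult: "p \<in> poly_functions n k \<Longrightarrow> q \<in> poly_functions n k \<Longrightarrow> (\<lambda>x. p x * q x) \<in> poly_functions n k"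

definition zariski_open :: "nat \<Rightarrow> nat \<Rightarrow> complex mat set \<Rightarrow> bool" where
  "zariski_open n k U \<longleftrightarrow>
     (\<exists>P \<subseteq> poly_functions n k. U = carrier_mat n k - {x. \<forall>p\<in>P. p x = 0})"

definition zariski :: "nat \<Rightarrow> nat \<Rightarrow> complex mat topology" where
  "zariski n k = topology (zariski_open n k)"

lemma istopology_zariski_open: "istopology (zariski_open n k)"
  unfolding istopology_def
proof (intro conjI allI impI)
  fix S T assume "zariski_open n k S" "zariski_open n k T"
  then obtain P Q where P: "P \<subseteq> poly_functions n k" "S = carrier_mat n k - {x. \<forall>p\<in>P. p x = 0}"
    and Q: "Q \<subseteq> poly_functions n k" "T = carrier_mat n k - {x. \<forall>q\<in>Q. q x = 0}"
    unfolding zariski_open_def by blast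
  let ?R = "(\<lambda>(p, q) x. p x * q x) ` (P \<times> Q)"
  have "?R \<subseteq> poly_functions n k"
    using P(1) Q(1) by (auto intro!: poly_functions.mult)
  moreover have "(\<forall>r\<in>?R. r x = 0) \<longleftrightarrow> (\<forall>p\<in>P. p x = 0) \<or> (\<forall>q\<in>Q. q x = 0)" for x
  proof -
    have "(\<forall>r\<in>?R. r x = 0) \<longleftrightarrow> (\<forall>p\<in>P. \<forall>q\<in>Q. p x = 0 \<or> q x = 0)"
      by (simp only: ball_simps split_paired_Ball_Sigma prod.case mult_eq_0_iff)
    then show ?thesis
      by meson
  qed
  then have "S \<inter> T = carrier_mat n k - {x. \<forall>r\<in>?R. r x = 0}"
    unfolding P(2) Q(2) by blast
  ultimately show "zariski_open n k (S \<inter> T)"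
    unfolding zariski_open_def by blast
next
  fix \<K> assume "\<forall>K\<in>\<K>. zariski_open n k K"
  then have "\<exists>P. \<forall>K\<in>\<K>. P K \<subseteq> poly_functions n k \<and>
      K = carrier_mat n k - {x. \<forall>p\<in>P K. p x = 0}"
    unfolding zariski_open_def by (rule bchoice)
  then obtain P where P: "\<forall>K\<in>\<K>. P K \<subseteq> poly_functions n k \<and>
      K = carrier_mat n k - {x. \<forall>p\<in>P K. p x = 0}" ..
  have "\<Union>\<K> = (\<Union>K\<in>\<K>. carrier_mat n k - {x. \<forall>p\<in>P K. p x = 0})"
    using P by (metis (no_types, lifting) SUP_cong image_ident)
  also have "\<dots> = carrier_mat n k - {x. \<forall>p\<in>(\<Union>K\<in>\<K>. P K). p x = 0}"
    by auto
  finally have "\<Union>\<K> = carrier_mat n k - {x. \<forall>p\<in>(\<Union>K\<in>\<K>. P K). p x = 0}" .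
  moreover have "(\<Union>K\<in>\<K>. P K) \<subseteq> poly_functions n k"
    using P by (intro UN_least) simp
  ultimately show "zariski_open n k (\<Union>\<K>)"
    unfolding zariski_open_def by (intro exI conjI)
qed

lemma openin_zariski: "openin (zariski n k) U \<longleftrightarrow> zariski_open n k U"
  by (simp add: zariski_def istopology_zariski_open)

lemma topspace_zariski: "topspace (zariski n k) = carrier_mat n k"
proof
  show "topspace (zariski n k) \<subseteq> carrier_mat n k"
    by (auto simp: topspace_def openin_zariski zariski_open_def)
  have "zariski_open n k (carrier_mat n k)"
    unfolding zariski_open_def
    by (rule exI[of _ "{\<lambda>_. 1}"]) (auto intro: poly_functions.const)
  then show "carrier_mat n k \<subseteq> topspace (zariski n k)"
    by (auto simp: topspace_def openin_zariski)
qed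

section \<open>Generic stabilizers\<close>

text \<open>The Lie algebra of an algebraic subgroup of \<open>GL\<^sub>k(\<complex>)\<close> is its Zariski tangent space at
  the identity: the matrices \<open>X\<close> annihilated by the differentials at the identity of all
  polynomials vanishing on the group.\<close>

definition lie_algebra :: "nat \<Rightarrow> complex mat set \<Rightarrow> complex mat set" where
  "lie_algebra k H =
     {X \<in> carrier_mat k k. \<forall>p \<in> poly_functions k k. (\<forall>h\<in>H. p h = 0) \<longrightarrow>
        ((\<lambda>t. p (1\<^sub>m k + t \<cdot>\<^sub>m X)) has_field_derivative 0) (at 0)}"

text \<open>Here \<open>G\<close> is an algebraic subgroup of \<open>GL\<^sub>k(\<complex>)\<close>, \<open>T\<close> the Zariski topology of the
  variety it acts on and \<open>\<phi>\<close> the action. Both left and right actions are allowed.\<close>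

definition has_generic_stabilizer ::
  "nat \<Rightarrow> complex mat monoid \<Rightarrow> 'x topology \<Rightarrow> (complex mat \<Rightarrow> 'x \<Rightarrow> 'x) \<Rightarrow> bool" where
  "has_generic_stabilizer k G T \<phi> \<longleftrightarrow>
     (\<exists>U. openin T U \<and> T closure_of U = topspace T \<and>
        (\<forall>x\<in>U. \<forall>y\<in>U. \<exists>g\<in>carrier G.
           lie_algebra k (stabilizer G \<phi> y) =
           (\<lambda>X. g * X * inv\<^bsub>G\<^esub> g) ` lie_algebra k (stabilizer G \<phi> x)))"

section \<open>The reparametrization group and its action on jets\<close>

text \<open>Matrix indices start at 0, hence the shifts by one. The value \<open>a s\<close> is the coefficient of
  \<open>t\<^sup>s\<close> in the reparametrization; only \<open>a 1, \<dots>, a k\<close> occur in the matrix.\<close>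

definition reparam_mat :: "nat \<Rightarrow> (nat \<Rightarrow> complex) \<Rightarrow> complex mat" where
  "reparam_mat k a = mat k k (\<lambda>(i, j).
     \<Sum>s | length s = i + 1 \<and> (\<forall>l\<in>set s. 1 \<le> l) \<and> sum_list s = j + 1. prod_list (map a s))"

definition reparam_group :: "nat \<Rightarrow> complex mat monoid" where
  "reparam_group k =
     \<lparr>carrier = {reparam_mat k a |a. a 1 \<noteq> 0}, monoid.mult = (*), one = 1\<^sub>m k\<rparr>"

text \<open>A jet of \<open>f\<close> is the \<open>n \<times> k\<close> matrix whose \<open>j\<close>-th column (counting from 1) is
  \<open>f\<^sup>(\<^sup>j\<^sup>)(0)/j!\<close>; the space of jets is \<^term>\<open>carrier_mat n k\<close>.\<close>

definition jet_action :: "complex mat \<Rightarrow> complex mat \<Rightarrow> complex mat" where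
  "jet_action A x = x * A"

subsection \<open>Relation to substitution of power series\<close>

definition reparam_series :: "(nat \<Rightarrow> complex) \<Rightarrow> complex fps" where
  "reparam_series a = Abs_fps (\<lambda>s. if s = 0 then 0 else a s)"

lemma reparam_series_nth [simp]:
  "fps_nth (reparam_series a) s = (if s = 0 then 0 else a s)"
  by (simp add: reparam_series_def)

lemma reparam_series_of_nth: "fps_nth f 0 = 0 \<Longrightarrow> reparam_series (fps_nth f) = f"
  by (simp add: fps_eq_iff)

lemma reparam_mat_carrier [simp]: "reparam_mat k a \<in> carrier_mat k k"
  by (simp add: reparam_mat_def)

lemma reparam_mat_dim [simp]:
  "dim_row (reparam_mat k a) = k" "dim_col (reparam_mat k a) = k"
  by (simp_all add: reparam_mat_def)

lemma reparam_mat_nth: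
  assumes "i < k" "j < k"
  shows "reparam_mat k a $$ (i, j) = fps_nth (reparam_series a ^ (i + 1)) (j + 1)"
proof -
  let ?c = "\<lambda>s. if s = 0 then 0 else a s"
  let ?S = "{s. length s = i + 1 \<and> (\<forall>l\<in>set s. 1 \<le> l) \<and> sum_list s = j + 1}"
  have "fps_nth (reparam_series a ^ (i + 1)) (j + 1) =
      (\<Sum>s\<in>natpermute (j + 1) (i + 1). \<Prod>l\<in>{0..i}. ?c (s ! l))"
    using fps_power_nth_Suc[of "reparam_series a" i "j + 1"] by simp
  also have "\<dots> = (\<Sum>s\<in>natpermute (j + 1) (i + 1). prod_list (map ?c s))"
    by (intro sum.cong refl)
      (auto simp: natpermute_def prod.list_conv_set_nth atLeastLessThanSuc_atLeastAtMost intro!: prod.cong)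
  also have "\<dots> = (\<Sum>s\<in>?S. prod_list (map a s))"
  proof (rule sum.mono_neutral_cong_right[OF natpermute_finite])
    show "?S \<subseteq> natpermute (j + 1) (i + 1)"
      by (auto simp: natpermute_def)
    show "\<forall>s\<in>natpermute (j + 1) (i + 1) - ?S. prod_list (map ?c s) = 0"
      by (force simp: natpermute_def prod_list_zero_iff not_le)
    show "prod_list (map ?c s) = prod_list (map a s)" if "s \<in> ?S" for s
      using that by (intro arg_cong[where f = prod_list] map_cong) auto
  qed
  also have "\<dots> = reparam_mat k a $$ (i, j)"
    using assms by (simp add: reparam_mat_def)
  finally show ?thesis by simp
qed

lemma sum_compose_reparam_series:
  assumes "fps_nth f 0 = 0" "j < k"
  shows "(\<Sum>l<k. fps_nth f (l + 1) * fps_nth (reparam_series a ^ (l + 1)) (j + 1)) =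
    fps_nth (f oo reparam_series a) (j + 1)"
proof -
  let ?g = "\<lambda>m. fps_nth f m * fps_nth (reparam_series a ^ m) (j + 1)"
  have "fps_nth (f oo reparam_series a) (j + 1) = sum ?g {0..j + 1}"
    by (simp add: fps_compose_nth)
  also have "\<dots> = sum ?g {0..k}"
    using assms by (intro sum.mono_neutral_left) (auto simp: startsby_zero_power_prefix)
  also have "\<dots> = sum ?g {1..k}"
    using assms by (intro sum.mono_neutral_right) (auto simp: not_less_eq_eq)
  also have "\<dots> = (\<Sum>l<k. ?g (l + 1))"
    by (rule sum.reindex_bij_witness[of _ "\<lambda>l. l + 1" "\<lambda>l. l - 1"]) auto
  finally show ?thesis by simp
qed

text \<open>Right multiplication by \<^term>\<open>reparam_mat k a\<close> is substitution of
  \<open>a\<^sub>1t + a\<^sub>2t\<^sup>2 + \<dots>\<close> into the components \<open>f i\<close> of a curve.\<close>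

lemma jet_action_reparam_mat:
  fixes f :: "nat \<Rightarrow> complex fps"
  assumes "\<And>i. i < n \<Longrightarrow> fps_nth (f i) 0 = 0"
  shows "jet_action (reparam_mat k a) (mat n k (\<lambda>(i, j). fps_nth (f i) (j + 1))) =
    mat n k (\<lambda>(i, j). fps_nth (f i oo reparam_series a) (j + 1))"
proof (rule eq_matI)
  fix i j assume ij: "i < dim_row (mat n k (\<lambda>(i, j). fps_nth (f i oo reparam_series a) (j + 1)))"
    "j < dim_col (mat n k (\<lambda>(i, j). fps_nth (f i oo reparam_series a) (j + 1)))"
  have "jet_action (reparam_mat k a) (mat n k (\<lambda>(i, j). fps_nth (f i) (j + 1))) $$ (i, j) =
      (\<Sum>l<k. fps_nth (f i) (l + 1) * reparam_mat k a $$ (l, j))"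
    using ij by (simp add: jet_action_def reparam_mat_def scalar_prod_def atLeast0LessThan)
  also have "\<dots> = (\<Sum>l<k. fps_nth (f i) (l + 1) * fps_nth (reparam_series a ^ (l + 1)) (j + 1))"
    using ij by (intro sum.cong) (simp_all add: reparam_mat_nth)
  also have "\<dots> = fps_nth (f i oo reparam_series a) (j + 1)"
    using ij assms by (intro sum_compose_reparam_series) auto
  finally show "jet_action (reparam_mat k a) (mat n k (\<lambda>(i, j). fps_nth (f i) (j + 1))) $$ (i, j) =
      mat n k (\<lambda>(i, j). fps_nth (f i oo reparam_series a) (j + 1)) $$ (i, j)"
    using ij by simp
qed (auto simp: jet_action_def reparam_mat_def)

lemma reparam_mat_mult:
  "reparam_mat k a * reparam_mat k b =
   reparam_mat k (fps_nth (reparam_series a oo reparam_series b))"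
proof -
  let ?f = "\<lambda>i. reparam_series a ^ (i + 1)"
  have a: "reparam_mat k a = mat k k (\<lambda>(i, j). fps_nth (?f i) (j + 1))"
    by (rule eq_matI) (simp_all add: reparam_mat_nth del: power_Suc)
  have "reparam_mat k a * reparam_mat k b =
      mat k k (\<lambda>(i, j). fps_nth (?f i oo reparam_series b) (j + 1))"
    using jet_action_reparam_mat[of k ?f k b] unfolding a[symmetric] jet_action_def by simp
  also have "\<dots> = reparam_mat k (fps_nth (reparam_series a oo reparam_series b))"
    by (rule eq_matI)
      (simp_all add: reparam_mat_nth reparam_series_of_nth fps_compose_power del: power_Suc)
  finally show ?thesis .
qed

lemma one_reparam_mat: "1\<^sub>m k = reparam_mat k (fps_nth fps_X)"
  by (rule eq_matI)
    (simp_all add: reparam_mat_nth reparam_series_of_nth fps_X_power_nth del: power_Suc)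

lemma group_reparam_group: "Group.group (reparam_group k)"
proof (rule groupI)
  fix A B assume "A \<in> carrier (reparam_group k)" "B \<in> carrier (reparam_group k)"
  then obtain a b where "A = reparam_mat k a" "B = reparam_mat k b" "a 1 \<noteq> 0" "b 1 \<noteq> 0"
    by (auto simp: reparam_group_def)
  moreover from this have "fps_nth (reparam_series a oo reparam_series b) 1 \<noteq> 0"
    by (simp add: fps_compose_nth)
  ultimately show "A \<otimes>\<^bsub>reparam_group k\<^esub> B \<in> carrier (reparam_group k)"
    unfolding reparam_group_def by (auto simp: reparam_mat_mult)
next
  have "fps_nth (fps_X :: complex fps) 1 \<noteq> 0" by simp
  then show "\<one>\<^bsub>reparam_group k\<^esub> \<in> carrier (reparam_group k)"
    unfolding reparam_group_def using one_reparam_mat by auto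
next
  fix A B C assume "A \<in> carrier (reparam_group k)" "B \<in> carrier (reparam_group k)"
    "C \<in> carrier (reparam_group k)"
  then show "A \<otimes>\<^bsub>reparam_group k\<^esub> B \<otimes>\<^bsub>reparam_group k\<^esub> C =
      A \<otimes>\<^bsub>reparam_group k\<^esub> (B \<otimes>\<^bsub>reparam_group k\<^esub> C)"
    by (auto simp: reparam_group_def intro!: assoc_mult_mat[of _ k k _ k _ k])
next
  fix A assume "A \<in> carrier (reparam_group k)"
  then show "\<one>\<^bsub>reparam_group k\<^esub> \<otimes>\<^bsub>reparam_group k\<^esub> A = A"
    by (auto simp: reparam_group_def left_mult_one_mat[of _ k k])
next
  fix A assume "A \<in> carrier (reparam_group k)"
  then obtain a where a: "A = reparam_mat k a" "a 1 \<noteq> 0"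
    by (auto simp: reparam_group_def)
  let ?b = "fps_inv (reparam_series a)"
  have b0: "fps_nth ?b 0 = 0"
    by (simp add: fps_inv_def)
  have inv: "?b oo reparam_series a = fps_X"
    using a by (intro fps_inv) auto
  have "fps_nth (?b oo reparam_series a) 1 = fps_nth ?b 1 * a 1"
    by (simp add: fps_compose_nth)
  then have "fps_nth ?b 1 \<noteq> 0"
    unfolding inv by auto
  moreover have "reparam_mat k (fps_nth ?b) * A = 1\<^sub>m k"
    by (simp add: a reparam_mat_mult reparam_series_of_nth b0 inv one_reparam_mat)
  ultimately show "\<exists>B\<in>carrier (reparam_group k). B \<otimes>\<^bsub>reparam_group k\<^esub> A = \<one>\<^bsub>reparam_group k\<^esub>"
    unfolding reparam_group_def by auto
qed

end

theory Submission
  imports Defs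
begin

text \<open>On the dense open set of jets whose first component has nonzero derivative the stabilizer is
  trivial: the first row of such a jet is also the first row of an element of the group, and
  group elements are determined by their first row, so cancellation applies.\<close>

text \<open>Row 0 belongs to the first power of the series, so the coefficients of the
  reparametrization can be read off from it.\<close>

lemma reparam_mat_nth_first:
  assumes "j < k"
  shows "reparam_mat k a $$ (0, j) = a (j + 1)"
  using assms by (subst reparam_mat_nth) auto

text \<open>The parts of a composition of \<open>j + 1\<close> with \<open>j < k\<close> lie between
  1 and \<open>k\<close>, so no other value of \<open>a\<close> enters an entry.\<close>

lemma reparam_mat_cong:
  assumes "\<And>s. 1 \<le> s \<Longrightarrow> s \<le> k \<Longrightarrow> a s = b s"
  shows "reparam_mat k a = reparam_mat k b"
proof -
  have "prod_list (map a s) = prod_list (map b s)"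
    if "j < k" "\<forall>l\<in>set s. 1 \<le> l" "sum_list s = j + 1" for j s
  proof (intro arg_cong[where f = prod_list] map_cong refl)
    fix l assume l: "l \<in> set s"
    then have "l \<le> sum_list s"
      by (simp add: member_le_sum_list)
    with l that show "a l = b l"
      by (intro assms) auto
  qed
  then show ?thesis
    unfolding reparam_mat_def by (intro cong_mat refl) (auto intro!: sum.cong)
qed

lemma reparam_group_eqI:
  assumes "A \<in> carrier (reparam_group k)" "B \<in> carrier (reparam_group k)"
    and "\<And>j. j < k \<Longrightarrow> A $$ (0, j) = B $$ (0, j)"
  shows "A = B"
proof -
  obtain a b where a: "A = reparam_mat k a" and b: "B = reparam_mat k b"
    using assms(1,2) by (auto simp: reparam_group_def)
  \<comment> \<open>Columns are counted from 0, so the coefficient of \<open>t^s\<close> stands in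
    column \<open>s - 1\<close>.\<close>
  have "a s = b s" if "1 \<le> s" "s \<le> k" for s
    using assms(3)[of "s - 1"] that unfolding a b by (simp add: reparam_mat_nth_first)
  then show ?thesis
    unfolding a b by (rule reparam_mat_cong)
qed

lemma stabilizer_jet_action_trivial:
  assumes "k \<ge> 1" "n \<ge> 1" and x: "x \<in> carrier_mat n k" "x $$ (0, 0) \<noteq> 0"
  shows "stabilizer (reparam_group k) jet_action x = {1\<^sub>m k}"
proof -
  interpret G: Group.group "reparam_group k"
    by (rule group_reparam_group)
  have one: "\<one>\<^bsub>reparam_group k\<^esub> = 1\<^sub>m k"
    by (simp add: reparam_group_def)
  have "A = 1\<^sub>m k" if A: "A \<in> carrier (reparam_group k)" and fixed: "x * A = x" for A
  proof -
    \<comment> \<open>The group element whose first row is that of \<open>x\<close>. Its leading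
      coefficient is \<open>x $$ (0, 0)\<close>, which is nonzero; the truncated value at
      \<open>s = 0\<close> is harmless, as parts are at least 1.\<close>
    let ?X = "reparam_mat k (\<lambda>s. x $$ (0, s - 1))"
    have X: "?X \<in> carrier (reparam_group k)"
      using x by (auto simp: reparam_group_def)
    have dim: "A \<in> carrier_mat k k"
      using A by (auto simp: reparam_group_def)
    have row: "row ?X 0 = row x 0"
      using assms by (intro eq_vecI) (auto simp: reparam_mat_nth_first)
    \<comment> \<open>Row 0 of a product depends only on row 0 of the left factor, so
      \<open>x * A = x\<close> already fixes the first row of \<open>?X * A\<close>, and this row
      determines a group element.\<close>
    have "?X \<otimes>\<^bsub>reparam_group k\<^esub> A = ?X"
    proof (rule reparam_group_eqI)
      fix j assume j: "j < k"
      have "(?X * A) $$ (0, j) = (x * A) $$ (0, j)"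
        using assms j dim row by simp
      then show "(?X \<otimes>\<^bsub>reparam_group k\<^esub> A) $$ (0, j) = ?X $$ (0, j)"
        using fixed j by (simp add: reparam_group_def reparam_mat_nth_first)
    qed (use A X in auto)
    then show ?thesis
      using A X one by (simp add: G.r_cancel_one)
  qed
  moreover have "x * 1\<^sub>m k = x" "1\<^sub>m k \<in> carrier (reparam_group k)"
    using x G.one_closed unfolding one by simp_all
  ultimately show ?thesis
    unfolding stabilizer_def jet_action_def by blast
qed

text \<open>This replaces Zariski density by a limit argument in one complex variable: on a line
  each entry is affine in \<open>t\<close>, and sums and products preserve continuity.\<close>

lemma poly_functions_continuous_on_line:
  assumes "p \<in> poly_functions n k" "x \<in> carrier_mat n k" "y \<in> carrier_mat n k"
  shows "continuous_on UNIV (\<lambda>t. p (x + t \<cdot>\<^sub>m y))"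
  using assms(1)
proof induction
  case (entry i j)
  then have "(\<lambda>t. (x + t \<cdot>\<^sub>m y) $$ (i, j)) = (\<lambda>t. x $$ (i, j) + t * y $$ (i, j))"
    using assms(2,3) by auto
  then show ?case
    by (simp only:) (intro continuous_intros)
qed (auto intro: continuous_intros)

lemma openin_zariski_nonvanishing:
  assumes "p \<in> poly_functions n k"
  shows "openin (zariski n k) {x \<in> carrier_mat n k. p x \<noteq> 0}"
  unfolding openin_zariski zariski_open_def
  using assms by (intro exI[of _ "{p}"]) auto

text \<open>A polynomial not vanishing at a point does not vanish near it on any line through it, and
  the entry vanishes at only one point of the line in the direction of that entry.\<close>

lemma zariski_closure_of_nonvanishing_entry:
  assumes "i < n" "j < k"
  shows "zariski n k closure_of {x \<in> carrier_mat n k. x $$ (i, j) \<noteq> 0} = carrier_mat n k"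
proof -
  let ?U = "{x \<in> carrier_mat n k. x $$ (i, j) \<noteq> 0}"
  have "\<exists>y\<in>?U. y \<in> T" if x: "x \<in> carrier_mat n k" "x \<in> T" and T: "openin (zariski n k) T" for x T
  proof -
    obtain P where P: "P \<subseteq> poly_functions n k" "T = carrier_mat n k - {x. \<forall>p\<in>P. p x = 0}"
      using T unfolding openin_zariski zariski_open_def by blast
    then obtain p where p: "p \<in> P" "p x \<noteq> 0"
      using x by blast
    \<comment> \<open>Moving along this matrix unit adds \<open>t\<close> to the entry
      \<open>(i, j)\<close>, which then vanishes only for
      \<open>t = - (x $$ (i, j))\<close>.\<close>
    define E :: "complex mat" where "E = mat n k (\<lambda>ab. if ab = (i, j) then 1 else 0)"
    have E: "E \<in> carrier_mat n k" "E $$ (i, j) = 1"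
      using assms by (simp_all add: E_def)
    have "x + 0 \<cdot>\<^sub>m E = x"
      using x E by (intro eq_matI) auto
    moreover have "((\<lambda>t. p (x + t \<cdot>\<^sub>m E)) \<longlongrightarrow> p (x + 0 \<cdot>\<^sub>m E)) (at 0)"
      using poly_functions_continuous_on_line[of p n k x E] p P x E
      by (auto simp: continuous_on_def)
    ultimately have "\<forall>\<^sub>F t in at 0. p (x + t \<cdot>\<^sub>m E) \<noteq> 0"
      using p(2) by (intro tendsto_imp_eventually_ne) auto
    \<comment> \<open>The excluded value is either 0, which the punctured neighbourhood omits, or
      differs from the limit 0 of \<open>t\<close>.\<close>
    moreover have "\<forall>\<^sub>F t in at 0. t \<noteq> - (x $$ (i, j))"
    proof (cases "x $$ (i, j) = 0")
      case True
      then show ?thesis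
        by (simp add: eventually_neq_at_within)
    next
      case False
      then show ?thesis
        by (intro tendsto_imp_eventually_ne[OF tendsto_ident_at]) simp
    qed
    ultimately have "\<forall>\<^sub>F t in at 0. p (x + t \<cdot>\<^sub>m E) \<noteq> 0 \<and> t \<noteq> - (x $$ (i, j))"
      by (rule eventually_conj)
    then obtain t where t: "p (x + t \<cdot>\<^sub>m E) \<noteq> 0" "t \<noteq> - (x $$ (i, j))"
      using eventually_happens'[OF at_neq_bot] by blast
    have "(x + t \<cdot>\<^sub>m E) $$ (i, j) = x $$ (i, j) + t"
      using assms x E by auto
    with t p P x E show ?thesis
      by (intro bexI[of _ "x + t \<cdot>\<^sub>m E"]) (auto simp: add_eq_0_iff minus_equation_iff)
  qed
  then show ?thesis
    unfolding closure_of_def topspace_zariski by blast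
qed

theorem theorem4p4:
  fixes k n :: nat
  assumes "k \<ge> 1" and "n \<ge> 1"
  shows "has_generic_stabilizer k (reparam_group k) (zariski n k) jet_action"
proof -
  interpret G: Group.group "reparam_group k"
    by (rule group_reparam_group)
  let ?U = "{x \<in> carrier_mat n k. x $$ (0, 0) \<noteq> (0 :: complex)}"
  have one: "\<one>\<^bsub>reparam_group k\<^esub> = 1\<^sub>m k"
    by (simp add: reparam_group_def)
  have "openin (zariski n k) ?U"
    using assms by (intro openin_zariski_nonvanishing poly_functions.entry) auto
  moreover have "zariski n k closure_of ?U = topspace (zariski n k)"
    using assms by (subst topspace_zariski, intro zariski_closure_of_nonvanishing_entry) auto
  moreover have "\<exists>g\<in>carrier (reparam_group k).
      lie_algebra k (stabilizer (reparam_group k) jet_action y) =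
      (\<lambda>X. g * X * inv\<^bsub>reparam_group k\<^esub> g) ` lie_algebra k (stabilizer (reparam_group k) jet_action x)"
    if "x \<in> ?U" "y \<in> ?U" for x y
  proof -
    have eq: "stabilizer (reparam_group k) jet_action z = {1\<^sub>m k}" if "z \<in> ?U" for z
      using assms that by (intro stabilizer_jet_action_trivial[of k n]) auto
    \<comment> \<open>Both stabilizers are the same trivial group, so their Lie algebras agree and
      the identity serves as the conjugating element.\<close>
    have "1\<^sub>m k * X * inv\<^bsub>reparam_group k\<^esub> (1\<^sub>m k) = X" if "X \<in> lie_algebra k H" for X H
    proof -
      have "X \<in> carrier_mat k k"
        using that by (simp add: lie_algebra_def)
      then show ?thesis
        using G.inv_one unfolding one by simp
    qed
    then show ?thesis
      using G.one_closed unfolding one eq[OF that(1)] eq[OF that(2)]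
      by (intro bexI[of _ "1\<^sub>m k"]) (simp_all cong: image_cong_simp)
  qed
  ultimately show ?thesis
    unfolding has_generic_stabilizer_def by blast
qed

end
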